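(* Let $P$ be an irreducible, aperiodic transition matrix on a finite state space $\mathcal{X}$, reversible with respect to its stationary distribution $\pi$, with all eigenvalues positive. Suppose that for every probability distribution $\alpha\ne\pi$ on $\mathcal{X}$ the limiting distribution $$\varphi^\alpha_\star(y)=\lim_{t\to\infty}\mathbb{P}_\alpha(X_t=y\mid\tau^\alpha_\pi>t),\qquad y\in\mathcal{X},$$ exists. Then for every $\alpha\neq\pi$ there exists a pair $(v^\alpha,\lambda^\alpha)\in\mathbb{R}^{|\mathcal{X}|}\times(0,1)$, with $v^\alpha$ viewed as a row vector, such that $$v^\alpha P=\lambda^\alpha v^\alpha$$ and the following hold: (1) $\varphi^\alpha_\star$ is in the span of $v^\alpha$ and $\pi$; in particular $\varphi^\alpha_\star=v^\alpha+\pi$. (2) $\varphi^\alpha_\star P^t=(\lambda^\alpha)^t\varphi^\alpha_\star+\left(1-(\lambda^\alpha)^t\right)\pi$ for all $t\ge 0$. (3) The separation distance starting at $\alpha$ decays exponentially at rate $\lambda^\alpha$, i.e. $\lim_{t\to\infty}(s^\alpha_t)^{1/t}=\lambda^\alpha$. (4) There exists some $y\in\mathcal{X}$ such that $\varphi^\alpha_\star(y)=0$.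
   Context: $(X_t)_{t\ge 0}$ is a discrete-time Markov chain on the finite set $\mathcal{X}$ with transition matrix $P$; $\mathbb{P}_\alpha$ denotes the law of the chain (together with any additional randomness needed to define randomized stopping times) with $X_0\sim\alpha$. Distributions are viewed as row vectors. All entries of $\pi$ are positive. For a probability distribution $\alpha$ on $\mathcal{X}$ set $$\mu^\alpha_t(y)=\sum_{x\in\mathcal{X}}\alpha(x)P^t(x,y),\qquad s^\alpha_t=\max_{y\in\mathcal{X}}\left(1-\frac{\mu^\alpha_t(y)}{\pi(y)}\right),\qquad t\ge 0$$ ($s_t^\alpha$ is the separation distance from stationarity). An optimal strong stationary time $\tau^\alpha_\pi$ is a randomized stopping time such that $$\mathbb{P}_\alpha(X_t=y,\ \tau^\alpha_\pi\le t)=\pi(y)\,\mathbb{P}_\alpha(\tau^\alpha_\pi\le t)\quad\text{for all } t\ge 0,\ y\in\mathcal{X},$$ and $$\mathbb{P}_\alpha(\tau^\alpha_\pi>t)=s^\alpha_t\quad\text{for all } t\ge 0.$$ *)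

theory Defs
  imports "HOL-Probability.Probability" "HOL-Library.Extended_Nat"
begin

text \<open>
  The finite state space is a type \<open>'s :: finite\<close>. Distributions are vectors in \<open>real ^ 's\<close>,
  and \<open>\<mu> v* P\<close> is the row vector \<open>\<mu>\<close> times the matrix \<open>P\<close>.
\<close>

definition prob_vec :: "real ^ 's::finite \<Rightarrow> bool" where
  "prob_vec \<mu> \<longleftrightarrow> (\<forall>x. 0 \<le> \<mu> $ x) \<and> (\<Sum>x\<in>UNIV. \<mu> $ x) = 1"

definition transition_matrix :: "real ^ 's ^ 's::finite \<Rightarrow> bool" where
  "transition_matrix P \<longleftrightarrow> (\<forall>x. prob_vec (P $ x))"

text \<open>
  The overloaded power \<open>P ^ t\<close> on \<open>real ^ 's ^ 's\<close> is entrywise, so the matrix power needs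
  its own definition.
\<close>

primrec mat_power :: "real ^ 's ^ 's::finite \<Rightarrow> nat \<Rightarrow> real ^ 's ^ 's" where
  "mat_power P 0 = mat 1"
| "mat_power P (Suc t) = mat_power P t ** P"

definition irreducible_matrix :: "real ^ 's ^ 's::finite \<Rightarrow> bool" where
  "irreducible_matrix P \<longleftrightarrow> (\<forall>x y. \<exists>t. 0 < mat_power P t $ x $ y)"

definition aperiodic_matrix :: "real ^ 's ^ 's::finite \<Rightarrow> bool" where
  "aperiodic_matrix P \<longleftrightarrow> (\<forall>x. Gcd {t. 1 \<le> t \<and> 0 < mat_power P t $ x $ x} = 1)"

definition stationary_distribution :: "real ^ 's ^ 's::finite \<Rightarrow> real ^ 's \<Rightarrow> bool" where
  "stationary_distribution P \<pi> \<longleftrightarrow> prob_vec \<pi> \<and> \<pi> v* P = \<pi>"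

definition reversible :: "real ^ 's ^ 's::finite \<Rightarrow> real ^ 's \<Rightarrow> bool" where
  "reversible P \<pi> \<longleftrightarrow> (\<forall>x y. \<pi> $ x * P $ x $ y = \<pi> $ y * P $ y $ x)"

text \<open>
  Only real eigenvalues are considered: a matrix reversible with respect to a positive \<open>\<pi>\<close> is
  self-adjoint for the \<open>\<pi>\<close>-weighted inner product and has no others.
\<close>

definition eigenvalue :: "real ^ 's ^ 's::finite \<Rightarrow> real \<Rightarrow> bool" where
  "eigenvalue P \<mu> \<longleftrightarrow> (\<exists>f. f \<noteq> 0 \<and> P *v f = \<mu> *\<^sub>R f)"

definition marginal :: "real ^ 's ^ 's::finite \<Rightarrow> real ^ 's \<Rightarrow> nat \<Rightarrow> real ^ 's" where
  "marginal P \<alpha> t = \<alpha> v* mat_power P t"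

definition separation ::
  "real ^ 's ^ 's::finite \<Rightarrow> real ^ 's \<Rightarrow> real ^ 's \<Rightarrow> nat \<Rightarrow> real" where
  "separation P \<pi> \<alpha> t = (MAX y. 1 - marginal P \<alpha> t $ y / \<pi> $ y)"

text \<open>
  The probability space \<open>M\<close> may carry randomness beyond the chain, and the filtration \<open>F\<close> may be
  larger than the one generated by \<open>X\<close>; the Markov property is with respect to \<open>F\<close>.
\<close>

definition markov_chain ::
  "real ^ 's ^ 's::finite \<Rightarrow> real ^ 's \<Rightarrow> 'w measure \<Rightarrow> (nat \<Rightarrow> 'w measure) \<Rightarrow> (nat \<Rightarrow> 'w \<Rightarrow> 's) \<Rightarrow> bool"
where
  "markov_chain P \<alpha> M F X \<longleftrightarrow>
     prob_space M \<and> filtration (space M) F \<and>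
     (\<forall>t. subalgebra M (F t)) \<and>
     (\<forall>t. X t \<in> measurable (F t) (count_space UNIV)) \<and>
     (\<forall>x. \<P>(\<omega> in M. X 0 \<omega> = x) = \<alpha> $ x) \<and>
     (\<forall>t y. AE \<omega> in M.
        real_cond_exp M (F t) (indicator {\<omega> \<in> space M. X (Suc t) \<omega> = y}) \<omega> = P $ X t \<omega> $ y)"

text \<open>
  A randomized stopping time of \<open>X\<close> is a stopping time of such an \<open>F\<close>. It may be infinite, whereas
  \<open>stopping_time\<close> would force the time to have the index type of \<open>F\<close>.
\<close>

definition randomized_stopping_time ::
  "real ^ 's ^ 's::finite \<Rightarrow> real ^ 's \<Rightarrow> 'w measure \<Rightarrow> (nat \<Rightarrow> 'w measure) \<Rightarrow> (nat \<Rightarrow> 'w \<Rightarrow> 's) \<Rightarrow>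
   ('w \<Rightarrow> enat) \<Rightarrow> bool"
where
  "randomized_stopping_time P \<alpha> M F X \<tau> \<longleftrightarrow>
     markov_chain P \<alpha> M F X \<and> (\<forall>t. Measurable.pred (F t) (\<lambda>\<omega>. \<tau> \<omega> \<le> enat t))"

definition optimal_strong_stationary_time ::
  "real ^ 's ^ 's::finite \<Rightarrow> real ^ 's \<Rightarrow> real ^ 's \<Rightarrow> 'w measure \<Rightarrow> (nat \<Rightarrow> 'w measure) \<Rightarrow>
   (nat \<Rightarrow> 'w \<Rightarrow> 's) \<Rightarrow> ('w \<Rightarrow> enat) \<Rightarrow> bool"
where
  "optimal_strong_stationary_time P \<pi> \<alpha> M F X \<tau> \<longleftrightarrow>
     randomized_stopping_time P \<alpha> M F X \<tau> \<and>
     (\<forall>t y. \<P>(\<omega> in M. X t \<omega> = y \<and> \<tau> \<omega> \<le> enat t) = \<pi> $ y * \<P>(\<omega> in M. \<tau> \<omega> \<le> enat t)) \<and>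
     (\<forall>t. \<P>(\<omega> in M. enat t < \<tau> \<omega>) = separation P \<pi> \<alpha> t)"

end

theory Submission
  imports Defs
begin

text \<open>
  Write \<open>\<mu>\<^sub>t\<close> for the law of the chain at time \<open>t\<close> and \<open>s\<^sub>t\<close> for the separation. An optimal
  strong stationary time leaves the mass \<open>\<pi> (1 - s\<^sub>t)\<close> on the event that it has already occurred,
  so the law of the chain conditioned on the complementary event is \<open>\<pi> + w\<^sub>t\<close>, where \<open>w\<^sub>t = (\<mu>\<^sub>t - \<pi>) / s\<^sub>t\<close>
  (lemma \<open>optimal_strong_stationary_time_conditional_law\<close>). From here on the argument is linear
  algebra for the sequence \<open>w\<^sub>t\<close>, which by hypothesis converges to \<open>v = \<phi> - \<pi>\<close>.

  Positivity of the spectrum makes \<open>P\<close> injective on row vectors, so \<open>\<mu>\<^sub>t\<close> never reaches \<open>\<pi>\<close> and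
  \<open>s\<^sub>t > 0\<close>. The maximum defining \<open>s\<^sub>t\<close> is attained, which says that some coordinate of \<open>\<pi> + w\<^sub>t\<close>
  vanishes. There are finitely many coordinates, so this survives in the limit: \<open>\<phi>\<close> has a zero.
  As \<open>\<pi>\<close> has none, \<open>v \<noteq> 0\<close>. The identity \<open>w\<^sub>t P = (s\<^sub>t\<^sub>+\<^sub>1 / s\<^sub>t) w\<^sub>t\<^sub>+\<^sub>1\<close> then passes to the limit and makes \<open>v\<close> a left
  eigenvector, with some eigenvalue \<open>l\<close> (lemma \<open>scaled_orbit_limit_eigenvector\<close>).

  By reversibility \<open>f = v / \<pi>\<close> is a right eigenvector for the same \<open>l\<close>; thus \<open>l > 0\<close> by hypothesis,
  and \<open>l < 1\<close> by the maximum principle, because \<open>\<pi> \<bullet> f\<close> is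
  the total mass \<open>0\<close> of \<open>v\<close> (lemma \<open>eigenvalue_less_one\<close>). Pairing
  \<open>s\<^sub>t w\<^sub>t = (\<alpha> - \<pi>) P\<^sup>t\<close> with \<open>f\<close> gives \<open>s\<^sub>t (w\<^sub>t \<bullet> f) = l\<^sup>t ((\<alpha> - \<pi>) \<bullet> f)\<close>. The factor \<open>w\<^sub>t \<bullet> f\<close>
  tends to \<open>v \<bullet> f\<close>, the sum of the \<open>v(y)\<^sup>2 / \<pi>(y)\<close>, which is positive. So \<open>s\<^sub>t\<close> is asymptotic to a
  positive constant times \<open>l\<^sup>t\<close>, which is more than the claimed root limit.
\<close>

section \<open>Row vectors and powers of a transition matrix\<close>

lemma vector_matrix_mult_nth: "(x v* A) $ y = (\<Sum>i\<in>UNIV. x $ i * A $ i $ y)"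
  for A :: "real ^ 'n ^ 'm"
  by (simp add: vector_matrix_mult_def mult.commute)

lemma scaleR_vector_matrix: "(c *\<^sub>R x) v* A = c *\<^sub>R (x v* A)"
  for A :: "real ^ 'n ^ 'm"
  by (simp add: vec_eq_iff vector_matrix_mult_nth sum_distrib_left mult.assoc)

lemma diff_vector_matrix: "(x - y) v* A = x v* A - y v* A"
  for A :: "real ^ 'n ^ 'm"
  by (simp add: vec_eq_iff vector_matrix_mult_nth sum_subtractf left_diff_distrib)

lemma add_vector_matrix: "(x + y) v* A = x v* A + y v* A"
  for A :: "real ^ 'n ^ 'm"
  by (simp add: vec_eq_iff vector_matrix_mult_nth sum.distrib distrib_right)

lemma prob_vec_step:
  assumes "prob_vec \<mu>" "transition_matrix P"
  shows "prob_vec (\<mu> v* P)"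
proof -
  have "(\<Sum>y\<in>UNIV. (\<mu> v* P) $ y) = (\<Sum>x\<in>UNIV. \<mu> $ x * (\<Sum>y\<in>UNIV. P $ x $ y))"
    unfolding vector_matrix_mult_nth sum_distrib_left by (rule sum.swap)
  also have "\<dots> = 1"
    using assms by (simp add: prob_vec_def transition_matrix_def)
  finally show ?thesis
    using assms
    by (auto simp: prob_vec_def transition_matrix_def vector_matrix_mult_nth intro!: sum_nonneg)
qed

lemma transition_matrix_power:
  assumes "transition_matrix P"
  shows "transition_matrix (mat_power P t)"
proof (induction t)
  case 0
  show ?case
    by (simp add: transition_matrix_def prob_vec_def mat_def)
next
  case (Suc t)
  have "mat_power P (Suc t) $ x = (mat_power P t $ x) v* P" for x
    by (simp add: vec_eq_iff vector_matrix_mult_nth matrix_matrix_mult_def)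
  then show ?case
    using Suc assms prob_vec_step unfolding transition_matrix_def
    by metis
qed

lemma left_eigenvector_mat_power:
  assumes "x v* P = l *\<^sub>R x"
  shows "x v* mat_power P t = l ^ t *\<^sub>R x"
proof (induction t)
  case (Suc t)
  have "x v* mat_power P (Suc t) = (x v* mat_power P t) v* P"
    by (simp add: vector_matrix_mul_assoc)
  then show ?case
    using Suc assms by (simp add: scaleR_vector_matrix mult.commute)
qed simp

lemma right_eigenvector_mat_power:
  assumes "P *v f = l *\<^sub>R f"
  shows "mat_power P t *v f = l ^ t *\<^sub>R f"
proof (induction t)
  case (Suc t)
  have "mat_power P (Suc t) *v f = mat_power P t *v (P *v f)"
    by (simp add: matrix_vector_mul_assoc)
  then show ?case
    using Suc assms by (simp add: matrix_vector_mult_scaleR)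
qed simp

lemma marginal_0 [simp]: "marginal P \<alpha> 0 = \<alpha>"
  by (simp add: marginal_def)

lemma marginal_Suc: "marginal P \<alpha> (Suc t) = marginal P \<alpha> t v* P"
  by (simp add: marginal_def vector_matrix_mul_assoc)

lemma prob_vec_marginal:
  assumes "prob_vec \<alpha>" "transition_matrix P"
  shows "prob_vec (marginal P \<alpha> t)"
  by (induction t) (simp_all add: assms marginal_Suc prob_vec_step)

section \<open>Spectral consequences of reversibility and irreducibility\<close>

text \<open>
  Detailed balance \<open>\<pi>(x) P(x, y) = \<pi>(y) P(y, x)\<close> turns the action of \<open>P\<close> on densities with respect
  to \<open>\<pi>\<close> into its action on functions. Spectral hypotheses on column vectors thereby become
  available for row vectors.
\<close>

lemma reversible_left_eigenvector:
  assumes rev: "reversible P \<pi>" and pos: "\<And>x. 0 < \<pi> $ x" and v: "v v* P = l *\<^sub>R v"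
  shows "P *v (\<chi> x. v $ x / \<pi> $ x) = l *\<^sub>R (\<chi> x. v $ x / \<pi> $ x)"
proof -
  have "(\<Sum>y\<in>UNIV. P $ x $ y * (v $ y / \<pi> $ y)) = l * (v $ x / \<pi> $ x)" for x
  proof -
    have "P $ x $ y * (v $ y / \<pi> $ y) = v $ y * P $ y $ x / \<pi> $ x" for y
    proof -
      have "\<pi> $ x * P $ x $ y = \<pi> $ y * P $ y $ x"
        using rev by (simp add: reversible_def)
      then show ?thesis
        using pos[of x] pos[of y] by (simp add: field_simps)
    qed
    then have "(\<Sum>y\<in>UNIV. P $ x $ y * (v $ y / \<pi> $ y)) = (v v* P) $ x / \<pi> $ x"
      by (simp add: vector_matrix_mult_nth sum_divide_distrib)
    then show ?thesis
      using v by simp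
  qed
  then show ?thesis
    by (simp add: vec_eq_iff matrix_vector_mult_def)
qed

text \<open>
  Maximum principle. At a point where \<open>f\<close> is maximal, hence nonnegative by orthogonality to the
  positive vector \<open>\<pi>\<close>, an eigenvalue \<open>l \<ge> 1\<close> would make the average of \<open>f\<close> under
  each power of \<open>P\<close> at least its maximum. Irreducibility then makes \<open>f\<close> constant, and a constant
  orthogonal to \<open>\<pi>\<close> is zero.
\<close>

lemma eigenvalue_less_one:
  fixes P :: "real ^ 's ^ 's::finite"
  assumes P: "transition_matrix P" "irreducible_matrix P"
    and pos: "\<And>x. 0 < \<pi> $ x"
    and f: "P *v f = l *\<^sub>R f" and orth: "\<pi> \<bullet> f = 0" and f0: "f \<noteq> 0"
  shows "l < 1"
proof (rule ccontr)
  assume "\<not> l < 1"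
  then have l: "1 \<le> l" by simp
  have "Max (range (($) f)) \<in> range (($) f)"
    by (rule Max_in) auto
  then obtain x where x: "f $ x = Max (range (($) f))"
    by (metis imageE)
  have max: "f $ y \<le> f $ x" for y
    unfolding x by (rule Max_ge) auto
  have fx: "0 \<le> f $ x"
  proof (rule ccontr)
    assume "\<not> 0 \<le> f $ x"
    then have "f $ y < 0" for y using max[of y] by linarith
    then have "(\<Sum>y\<in>UNIV. \<pi> $ y * f $ y) < (\<Sum>y\<in>(UNIV :: 's set). 0)"
      by (intro sum_strict_mono) (auto simp: pos mult_pos_neg)
    then show False using orth by (simp add: inner_vec_def)
  qed
  have const: "f $ y = f $ x" for y
  proof -
    obtain t where t: "0 < mat_power P t $ x $ y"
      using P(2) unfolding irreducible_matrix_def by blast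
    let ?Q = "mat_power P t"
    have Q: "\<And>z. 0 \<le> ?Q $ x $ z" "(\<Sum>z\<in>UNIV. ?Q $ x $ z) = 1"
      using transition_matrix_power[OF P(1), of t]
      by (auto simp: transition_matrix_def prob_vec_def)
    have "f $ x \<le> l ^ t * f $ x"
      using l fx by (simp add: mult_le_cancel_right1 mult_right_mono[of 1 "l^t" "f $ x", simplified])
    also have "\<dots> = (?Q *v f) $ x"
      using right_eigenvector_mat_power[OF f, of t] by simp
    finally have "f $ x \<le> (\<Sum>z\<in>UNIV. ?Q $ x $ z * f $ z)"
      by (simp add: matrix_vector_mult_def)
    then have "(\<Sum>z\<in>UNIV. ?Q $ x $ z * (f $ x - f $ z)) \<le> 0"
      by (simp add: right_diff_distrib sum_subtractf Q flip: sum_distrib_right)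
    moreover have nn: "0 \<le> ?Q $ x $ z * (f $ x - f $ z)" for z
      using Q(1) max[of z] by simp
    ultimately have "(\<Sum>z\<in>UNIV. ?Q $ x $ z * (f $ x - f $ z)) = 0"
      by (intro antisym sum_nonneg) auto
    then have "?Q $ x $ y * (f $ x - f $ y) = 0"
      using nn by (simp add: sum_nonneg_eq_0_iff)
    then show ?thesis using t by simp
  qed
  have "(\<Sum>y\<in>UNIV. \<pi> $ y) * f $ x = \<pi> \<bullet> f"
    unfolding inner_vec_def inner_real_def sum_distrib_right
    by (intro sum.cong refl) (metis const)
  then have "(\<Sum>y\<in>UNIV. \<pi> $ y) * f $ x = 0"
    using orth by simp
  moreover have "0 < (\<Sum>y\<in>UNIV. \<pi> $ y)"
    by (intro sum_pos) (auto simp: pos)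
  ultimately have "f $ x = 0" by simp
  then show False using const f0 by (simp add: vec_eq_iff)
qed

text \<open>
  Without the eigenvalue \<open>0\<close>, \<open>P\<close> cannot annihilate the difference \<open>\<mu>\<^sub>t - \<pi>\<close> in one step, so
  stationarity is not reached in finite time.
\<close>

lemma marginal_neq_stationary:
  assumes rev: "reversible P \<pi>" and pos: "\<And>x. 0 < \<pi> $ x"
    and stat: "\<pi> v* P = \<pi>" and ev: "\<not> eigenvalue P 0" and "\<alpha> \<noteq> \<pi>"
  shows "marginal P \<alpha> t \<noteq> \<pi>"
proof (induction t)
  case (Suc t)
  show ?case
  proof
    assume "marginal P \<alpha> (Suc t) = \<pi>"
    then have "(marginal P \<alpha> t - \<pi>) v* P = 0 *\<^sub>R (marginal P \<alpha> t - \<pi>)"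
      by (simp add: diff_vector_matrix marginal_Suc stat)
    from reversible_left_eigenvector[OF rev pos this] ev
    have "(\<chi> x. (marginal P \<alpha> t - \<pi>) $ x / \<pi> $ x) = 0"
      unfolding eigenvalue_def by blast
    then have "marginal P \<alpha> t = \<pi>"
      using pos by (simp add: vec_eq_iff) (metis less_irrefl)
    with Suc show False by simp
  qed
qed (use assms in simp)

section \<open>The separation distance\<close>

lemma separation_le:
  assumes "0 < \<pi> $ y"
  shows "\<pi> $ y * (1 - separation P \<pi> \<alpha> t) \<le> marginal P \<alpha> t $ y"
proof -
  have "1 - marginal P \<alpha> t $ y / \<pi> $ y \<le> separation P \<pi> \<alpha> t"
    unfolding separation_def by (rule Max_ge) auto
  then show ?thesis using assms by (simp add: field_simps)
qed

lemma separation_attained: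
  assumes "\<And>y. 0 < \<pi> $ y"
  obtains y where "marginal P \<alpha> t $ y = \<pi> $ y * (1 - separation P \<pi> \<alpha> t)"
proof -
  have "separation P \<pi> \<alpha> t \<in> range (\<lambda>y. 1 - marginal P \<alpha> t $ y / \<pi> $ y)"
    unfolding separation_def by (rule Max_in) auto
  then obtain y where "separation P \<pi> \<alpha> t = 1 - marginal P \<alpha> t $ y / \<pi> $ y" by blast
  then show ?thesis using that[of y] assms[of y] by (simp add: field_simps)
qed

text \<open>
  Separation at most \<open>0\<close> means that \<open>\<mu>\<^sub>t\<close> dominates \<open>\<pi>\<close> pointwise, which for two probability
  vectors forces equality.
\<close>

lemma separation_pos:
  assumes pos: "\<And>y. 0 < \<pi> $ y" and "prob_vec \<pi>" "prob_vec (marginal P \<alpha> t)"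
    and ne: "marginal P \<alpha> t \<noteq> \<pi>"
  shows "0 < separation P \<pi> \<alpha> t"
proof (rule ccontr)
  assume "\<not> 0 < separation P \<pi> \<alpha> t"
  then have le: "\<pi> $ y \<le> marginal P \<alpha> t $ y" for y
    using separation_le[OF pos, of y P \<alpha> t]
      mult_left_mono[of 1 "1 - separation P \<pi> \<alpha> t" "\<pi> $ y"] pos[of y] by linarith
  have "(\<Sum>y\<in>UNIV. marginal P \<alpha> t $ y - \<pi> $ y) = 0"
    using assms(2,3) by (simp add: prob_vec_def sum_subtractf)
  then have "\<forall>y. marginal P \<alpha> t $ y - \<pi> $ y = 0"
    using le by (simp add: sum_nonneg_eq_0_iff)
  then show False using ne by (simp add: vec_eq_iff)
qed

section \<open>The conditional law before an optimal strong stationary time\<close>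

text \<open>
  The Markov property is given only through conditional expectations; integrating it over the whole
  space yields the one-step recursion for the laws.
\<close>

lemma markov_chain_marginal:
  assumes mc: "markov_chain P \<alpha> M F X"
  shows "\<P>(\<omega> in M. X t \<omega> = y) = marginal P \<alpha> t $ y"
proof -
  interpret prob_space M using mc by (simp add: markov_chain_def)
  have sub: "subalgebra M (F t)" for t using mc by (simp add: markov_chain_def)
  have X: "X t \<in> measurable M (count_space UNIV)" for t
    by (rule measurable_from_subalg[OF sub[of t]]) (use mc in \<open>simp add: markov_chain_def\<close>)
  have ind_int: "integrable M (indicator {\<omega> \<in> space M. X t \<omega> = y} :: _ \<Rightarrow> real)" for t y
    using X[of t] by (intro integrable_real_indicator) (auto simp: emeasure_eq_measure)
  have "\<forall>y. \<P>(\<omega> in M. X t \<omega> = y) = marginal P \<alpha> t $ y"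
  proof (induction t)
    case 0
    show ?case using mc by (simp add: markov_chain_def)
  next
    case (Suc t)
    show ?case
    proof
      fix y
      interpret fs: finite_measure_subalgebra M "F t"
        by unfold_locales (rule sub)
      let ?I = "indicator {\<omega> \<in> space M. X (Suc t) \<omega> = y} :: _ \<Rightarrow> real"
      have "\<P>(\<omega> in M. X (Suc t) \<omega> = y) = (\<integral>\<omega>. ?I \<omega> \<partial>M)"
        using X[of "Suc t"] by simp
      also have "\<dots> = (\<integral>\<omega>. real_cond_exp M (F t) ?I \<omega> \<partial>M)"
        by (rule fs.real_cond_exp_int(2)[OF ind_int, symmetric])
      also have "\<dots> = (\<integral>\<omega>. P $ X t \<omega> $ y \<partial>M)"
        using mc measurable_compose[OF X, of "\<lambda>x. P $ x $ y" borel t]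
        by (intro integral_cong_AE) (auto simp: markov_chain_def intro: borel_measurable_cond_exp2)
      also have "\<dots> = (\<integral>\<omega>. (\<Sum>x\<in>UNIV. P $ x $ y * indicator {\<omega> \<in> space M. X t \<omega> = x} \<omega>) \<partial>M)"
        by (intro Bochner_Integration.integral_cong)
          (auto simp: indicator_def if_distrib sum.delta cong: if_cong)
      also have "\<dots> = (\<Sum>x\<in>UNIV. P $ x $ y * \<P>(\<omega> in M. X t \<omega> = x))"
        using ind_int by (subst Bochner_Integration.integral_sum) (auto simp: Int_absorb2 Collect_restrict)
      also have "\<dots> = marginal P \<alpha> (Suc t) $ y"
        using Suc by (simp add: marginal_Suc vector_matrix_mult_nth mult.commute)
      finally show "\<P>(\<omega> in M. X (Suc t) \<omega> = y) = marginal P \<alpha> (Suc t) $ y" .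
    qed
  qed
  then show ?thesis by simp
qed

text \<open>
  The mass already stopped at \<open>y\<close> by time \<open>t\<close> is \<open>\<pi>(y) (1 - s\<^sub>t)\<close>; the rest of \<open>\<mu>\<^sub>t(y)\<close> belongs to
  the event of total mass \<open>s\<^sub>t\<close> that stopping has not yet occurred. The right-hand side depends only
  on \<open>P\<close>, \<open>\<pi>\<close> and \<open>\<alpha>\<close>, so the probability space can be forgotten afterwards.
\<close>

lemma optimal_strong_stationary_time_conditional_law:
  assumes opt: "optimal_strong_stationary_time P \<pi> \<alpha> M F X \<tau>"
  shows "\<P>(\<omega> in M. X t \<omega> = y \<bar> enat t < \<tau> \<omega>) =
    (marginal P \<alpha> t $ y - \<pi> $ y * (1 - separation P \<pi> \<alpha> t)) / separation P \<pi> \<alpha> t"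
proof -
  let ?s = "separation P \<pi> \<alpha> t"
  have mc: "markov_chain P \<alpha> M F X"
    and \<tau>F: "Measurable.pred (F t) (\<lambda>\<omega>. \<tau> \<omega> \<le> enat t)"
    and sst: "\<P>(\<omega> in M. X t \<omega> = y \<and> \<tau> \<omega> \<le> enat t) = \<pi> $ y * \<P>(\<omega> in M. \<tau> \<omega> \<le> enat t)"
    and s: "\<P>(\<omega> in M. enat t < \<tau> \<omega>) = ?s"
    using opt by (auto simp: optimal_strong_stationary_time_def randomized_stopping_time_def)
  interpret prob_space M using mc by (simp add: markov_chain_def)
  have sub: "subalgebra M (F t)" using mc by (simp add: markov_chain_def)
  have [measurable]: "X t \<in> measurable M (count_space UNIV)"
    by (rule measurable_from_subalg[OF sub]) (use mc in \<open>simp add: markov_chain_def\<close>)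
  have [measurable]: "Measurable.pred M (\<lambda>\<omega>. \<tau> \<omega> \<le> enat t)"
    by (rule measurable_from_subalg[OF sub \<tau>F])
  have "\<P>(\<omega> in M. enat t < \<tau> \<omega>) = 1 - \<P>(\<omega> in M. \<tau> \<omega> \<le> enat t)"
    by (subst prob_neg[symmetric]) (auto simp: not_le)
  then have le: "\<P>(\<omega> in M. \<tau> \<omega> \<le> enat t) = 1 - ?s" using s by simp
  have "\<P>(\<omega> in M. X t \<omega> = y) =
      \<P>(\<omega> in M. X t \<omega> = y \<and> \<tau> \<omega> \<le> enat t) + \<P>(\<omega> in M. X t \<omega> = y \<and> enat t < \<tau> \<omega>)"
    unfolding not_le[symmetric] by (subst finite_measure_Union[symmetric]) (auto intro!: arg_cong[where f="measure M"])
  then show ?thesis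
    using sst le s markov_chain_marginal[OF mc, of t y] by (simp add: cond_prob_def)
qed

section \<open>The limit of the conditional laws\<close>

lemma tendsto_vector_matrix_mult:
  fixes A :: "real ^ 'n ^ 'm"
  assumes "(w \<longlongrightarrow> v) G"
  shows "((\<lambda>t. w t v* A) \<longlongrightarrow> v v* A) G"
  using assms
  by (intro vec_tendstoI) (auto simp: vector_matrix_mult_nth intro!: tendsto_intros)

text \<open>
  The scaling factors \<open>r\<close> converge: reading the recursion at a coordinate where
  the limit \<open>v\<close> does not vanish expresses \<open>r\<close> eventually as a convergent quotient.
\<close>

lemma scaled_orbit_limit_eigenvector:
  fixes w :: "nat \<Rightarrow> real ^ 's::finite"
  assumes w: "w \<longlonglongrightarrow> v" and v: "v \<noteq> 0"
    and step: "\<And>t. w t v* P = r t *\<^sub>R w (Suc t)"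
  obtains l where "v v* P = l *\<^sub>R v"
proof -
  obtain y where y: "v $ y \<noteq> 0" using v by (auto simp: vec_eq_iff)
  define l where "l = (v v* P) $ y / v $ y"
  have ws: "(\<lambda>t. w (Suc t) $ z) \<longlonglongrightarrow> v $ z" for z
    by (intro tendsto_vec_nth LIMSEQ_Suc w)
  have wP: "(\<lambda>t. (w t v* P) $ z) \<longlonglongrightarrow> (v v* P) $ z" for z
    by (intro tendsto_vec_nth tendsto_vector_matrix_mult w)
  have "(\<lambda>t. (w t v* P) $ y / w (Suc t) $ y) \<longlonglongrightarrow> l"
    unfolding l_def by (intro tendsto_divide wP ws y)
  moreover have "\<forall>\<^sub>F t in sequentially. (w t v* P) $ y / w (Suc t) $ y = r t"
    using tendsto_imp_eventually_ne[OF ws y] by eventually_elim (simp add: step)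
  ultimately have r: "r \<longlonglongrightarrow> l" by (rule Lim_transform_eventually)
  have "(v v* P) $ z = l * v $ z" for z
  proof (rule LIMSEQ_unique[OF wP])
    show "(\<lambda>t. (w t v* P) $ z) \<longlonglongrightarrow> l * v $ z"
      unfolding step by (simp add: tendsto_mult[OF r ws])
  qed
  then have "v v* P = l *\<^sub>R v" by (simp add: vec_eq_iff)
  then show ?thesis by (rule that)
qed

text \<open>
  Here \<open>s t = l\<^sup>t (a / c t)\<close> as soon as \<open>c t \<noteq> 0\<close>, with \<open>a / c t\<close> tending to a positive number, whose
  \<open>t\<close>-th roots tend to \<open>1\<close>. Positivity of \<open>a\<close> follows from that of \<open>s\<close>, \<open>l\<close> and \<open>b\<close>.
\<close>

lemma geometric_root_limit:
  fixes s c :: "nat \<Rightarrow> real"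
  assumes l: "0 < l" and s: "\<And>t. 0 < s t"
    and lim: "(\<lambda>t. s t * c t) = (\<lambda>t. l ^ t * a)" "c \<longlonglongrightarrow> b" and b: "0 < b"
  shows "(\<lambda>t. s t powr (1 / real t)) \<longlonglongrightarrow> l"
proof -
  have ev: "\<forall>\<^sub>F t in sequentially. 0 < c t"
    using order_tendstoD(1)[OF lim(2) b] .
  have a: "0 < a"
  proof -
    obtain t where "0 < c t" using ev eventually_happens' sequentially_bot by blast
    then have "0 < l ^ t * a" using s[of t] fun_cong[OF lim(1), of t] by (metis mult_pos_pos)
    then show ?thesis using l by (simp add: zero_less_mult_iff)
  qed
  have inv0: "(\<lambda>t. 1 / real t) \<longlonglongrightarrow> 0" by (rule lim_1_over_n)
  have ratio: "(\<lambda>t. a / c t) \<longlonglongrightarrow> a / b"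
    using lim(2) b by (intro tendsto_intros) auto
  have "(\<lambda>t. (a / c t) powr (1 / real t)) \<longlonglongrightarrow> (a / b) powr 0"
    using a b by (intro tendsto_powr[OF ratio inv0]) auto
  then have "(\<lambda>t. l * (a / c t) powr (1 / real t)) \<longlonglongrightarrow> l"
    using a b tendsto_mult[OF tendsto_const[of l]] by fastforce
  moreover have "\<forall>\<^sub>F t in sequentially. l * (a / c t) powr (1 / real t) = s t powr (1 / real t)"
    using ev eventually_gt_at_top[of 0]
  proof eventually_elim
    case (elim t)
    have "s t = l ^ t * (a / c t)"
      using fun_cong[OF lim(1), of t] elim by (simp add: field_simps)
    also have "l ^ t = l powr real t" using l by (simp add: powr_realpow)
    finally show ?case
      using elim a l by (simp add: powr_mult powr_powr del: times_divide_eq_right) simp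
  qed
  ultimately show ?thesis by (rule Lim_transform_eventually)
qed

text \<open>
  The deterministic core of the theorem: the sequence whose limit \<open>\<phi>\<close> is taken is the conditional
  law computed above. The proof works with its deviation \<open>w\<close> from \<open>\<pi>\<close>.
\<close>

lemma separation_residual_limit:
  fixes P :: "real ^ 's ^ 's::finite"
  assumes P: "transition_matrix P" "irreducible_matrix P" "stationary_distribution P \<pi>"
    and pos: "\<And>x. 0 < \<pi> $ x" and rev: "reversible P \<pi>"
    and ev: "\<And>\<mu>. eigenvalue P \<mu> \<Longrightarrow> 0 < \<mu>"
    and \<alpha>: "prob_vec \<alpha>" "\<alpha> \<noteq> \<pi>"
    and lim: "\<And>y. (\<lambda>t. (marginal P \<alpha> t $ y - \<pi> $ y * (1 - separation P \<pi> \<alpha> t)) /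
                 separation P \<pi> \<alpha> t) \<longlonglongrightarrow> \<phi> $ y"
  obtains l where "0 < l" "l < 1" "(\<phi> - \<pi>) v* P = l *\<^sub>R (\<phi> - \<pi>)"
    "(\<lambda>t. separation P \<pi> \<alpha> t powr (1 / real t)) \<longlonglongrightarrow> l" "\<exists>y. \<phi> $ y = 0"
proof -
  have \<pi>: "prob_vec \<pi>" "\<pi> v* P = \<pi>" using P(3) by (auto simp: stationary_distribution_def)
  define s where "s = separation P \<pi> \<alpha>"
  define m where "m = marginal P \<alpha>"
  define w where "w t = (1 / s t) *\<^sub>R (m t - \<pi>)" for t
  define v where "v = \<phi> - \<pi>"
  have s: "0 < s t" for t
    unfolding s_def using ev
    by (intro separation_pos pos \<pi> prob_vec_marginal \<alpha> P(1) marginal_neq_stationary rev) force+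
  have m: "m t - \<pi> = s t *\<^sub>R w t" for t using s[of t] by (simp add: w_def)
  have res: "(m t $ y - \<pi> $ y * (1 - s t)) / s t = w t $ y + \<pi> $ y" for t y
    using s[of t] by (simp add: w_def field_simps)
  have wlim: "w \<longlonglongrightarrow> v"
  proof (rule vec_tendstoI)
    fix y
    have "(\<lambda>t. w t $ y + \<pi> $ y) \<longlonglongrightarrow> \<phi> $ y" using lim[of y] by (simp flip: s_def m_def add: res)
    from tendsto_diff[OF this tendsto_const[of "\<pi> $ y"]]
    show "(\<lambda>t. w t $ y) \<longlonglongrightarrow> v $ y" by (simp add: v_def)
  qed
  \<comment> \<open>The coordinate that vanishes may change with \<open>t\<close>. The product over all coordinates vanishes
    for every \<open>t\<close>, hence also in the limit.\<close>
  have zero: "\<exists>y. \<phi> $ y = 0"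
  proof -
    have "(\<Prod>y\<in>UNIV. w t $ y + \<pi> $ y) = 0" for t
    proof -
      obtain y where "m t $ y = \<pi> $ y * (1 - s t)"
        unfolding m_def s_def using separation_attained[OF pos] by blast
      then have "w t $ y + \<pi> $ y = 0" using res[of t y] by simp
      then show ?thesis by (intro prod_zero) auto
    qed
    moreover have "(\<lambda>t. \<Prod>y\<in>UNIV. w t $ y + \<pi> $ y) \<longlonglongrightarrow> (\<Prod>y\<in>UNIV. v $ y + \<pi> $ y)"
      using wlim by (intro tendsto_intros)
    ultimately have "(\<Prod>y\<in>UNIV. v $ y + \<pi> $ y) = 0"
      by (simp only: LIMSEQ_const_iff)
    then show ?thesis by (simp add: v_def)
  qed
  then have v0: "v \<noteq> 0" using pos by (auto simp: v_def vec_eq_iff) (metis less_irrefl)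
  have step: "w t v* P = (s (Suc t) / s t) *\<^sub>R w (Suc t)" for t
    using s[of "Suc t"]
    by (simp add: w_def m_def scaleR_vector_matrix diff_vector_matrix marginal_Suc \<pi>(2))
  obtain l where l: "v v* P = l *\<^sub>R v"
    using scaled_orbit_limit_eigenvector[OF wlim v0 step] by blast
  define f where "f = (\<chi> x. v $ x / \<pi> $ x)"
  have f: "P *v f = l *\<^sub>R f"
    unfolding f_def by (rule reversible_left_eigenvector[OF rev pos l])
  obtain z where z: "v $ z \<noteq> 0" using v0 by (auto simp: vec_eq_iff)
  have f0: "f \<noteq> 0" using z pos[of z] by (auto simp: f_def vec_eq_iff)
  have lpos: "0 < l" using f f0 ev unfolding eigenvalue_def by blast
  have "(\<Sum>y\<in>UNIV. w t $ y) = 0" for t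
  proof -
    have "(\<Sum>y\<in>UNIV. (m t - \<pi>) $ y) = 0"
      using prob_vec_marginal[OF \<alpha>(1) P(1), of t] \<pi>(1)
      by (simp add: prob_vec_def m_def sum_subtractf)
    then show ?thesis by (simp add: w_def flip: sum_divide_distrib)
  qed
  moreover have "(\<lambda>t. \<Sum>y\<in>UNIV. w t $ y) \<longlonglongrightarrow> (\<Sum>y\<in>UNIV. v $ y)"
    using wlim by (intro tendsto_intros)
  ultimately have v_sum: "(\<Sum>y\<in>UNIV. v $ y) = 0" by (simp add: LIMSEQ_const_iff)
  have "\<pi> $ y * f $ y = v $ y" for y using pos[of y] by (simp add: f_def)
  then have "\<pi> \<bullet> f = 0" using v_sum by (simp add: inner_vec_def)
  then have l1: "l < 1" by (rule eigenvalue_less_one[OF P(1,2) pos f _ f0])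
  \<comment> \<open>The eigenfunction \<open>f\<close> isolates the component of \<open>\<alpha> - \<pi>\<close> that decays exactly like \<open>l\<^sup>t\<close>.\<close>
  have pair: "s t * (w t \<bullet> f) = l ^ t * ((\<alpha> - \<pi>) \<bullet> f)" for t
  proof -
    have "\<pi> v* mat_power P t = \<pi>" using left_eigenvector_mat_power[of \<pi> P 1 t] \<pi>(2) by simp
    then have "s t *\<^sub>R w t = (\<alpha> - \<pi>) v* mat_power P t"
      by (simp add: m[symmetric] m_def marginal_def diff_vector_matrix)
    then have "s t * (w t \<bullet> f) = ((\<alpha> - \<pi>) v* mat_power P t) \<bullet> f"
      by (metis inner_scaleR_left)
    then show ?thesis
      by (simp add: dot_lmul_matrix right_eigenvector_mat_power[OF f])
  qed
  have "0 < (\<Sum>y\<in>UNIV. v $ y * f $ y)"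
    using z pos by (intro sum_pos2[of _ z]) (auto simp: f_def zero_less_mult_iff zero_less_divide_iff
      zero_le_mult_iff zero_le_divide_iff less_imp_le linorder_neq_iff)
  then have vf: "0 < v \<bullet> f" by (simp add: inner_vec_def)
  have "(\<lambda>t. s t powr (1 / real t)) \<longlonglongrightarrow> l"
  proof (rule geometric_root_limit[OF lpos s _ _ vf])
    show "(\<lambda>t. s t * (w t \<bullet> f)) = (\<lambda>t. l ^ t * ((\<alpha> - \<pi>) \<bullet> f))" using pair by blast
    show "(\<lambda>t. w t \<bullet> f) \<longlonglongrightarrow> v \<bullet> f" using wlim by (intro tendsto_intros)
  qed
  then show ?thesis using that lpos l1 l zero unfolding v_def s_def by blast
qed

theorem corollary2p5:
  fixes P :: "real ^ 's ^ 's::finite" and \<pi> :: "real ^ 's"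
    and M :: "real ^ 's \<Rightarrow> 'w measure" and F :: "real ^ 's \<Rightarrow> nat \<Rightarrow> 'w measure"
    and X :: "real ^ 's \<Rightarrow> nat \<Rightarrow> 'w \<Rightarrow> 's" and \<tau> :: "real ^ 's \<Rightarrow> 'w \<Rightarrow> enat"
    and \<phi> :: "real ^ 's \<Rightarrow> real ^ 's"
  assumes "transition_matrix P" and "irreducible_matrix P" and "aperiodic_matrix P"
    and "stationary_distribution P \<pi>" and "\<And>x. 0 < \<pi> $ x"
    and "reversible P \<pi>"
    and "\<And>\<mu>. eigenvalue P \<mu> \<Longrightarrow> 0 < \<mu>"
    and "\<And>\<alpha>. prob_vec \<alpha> \<Longrightarrow> \<alpha> \<noteq> \<pi> \<Longrightarrow>
           optimal_strong_stationary_time P \<pi> \<alpha> (M \<alpha>) (F \<alpha>) (X \<alpha>) (\<tau> \<alpha>)"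
    and "\<And>\<alpha> y. prob_vec \<alpha> \<Longrightarrow> \<alpha> \<noteq> \<pi> \<Longrightarrow>
           (\<lambda>t. \<P>(\<omega> in M \<alpha>. X \<alpha> t \<omega> = y \<bar> enat t < \<tau> \<alpha> \<omega>)) \<longlonglongrightarrow> \<phi> \<alpha> $ y"
  shows "\<forall>\<alpha>. prob_vec \<alpha> \<and> \<alpha> \<noteq> \<pi> \<longrightarrow>
    (\<exists>(v :: real ^ 's) (l :: real). 0 < l \<and> l < 1 \<and> v v* P = l *\<^sub>R v \<and>
       (\<phi> \<alpha> \<in> span {v, \<pi>} \<and> \<phi> \<alpha> = v + \<pi>) \<and>
       (\<forall>t. \<phi> \<alpha> v* mat_power P t = l ^ t *\<^sub>R \<phi> \<alpha> + (1 - l ^ t) *\<^sub>R \<pi>) \<and>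
       (\<lambda>t. separation P \<pi> \<alpha> t powr (1 / real t)) \<longlonglongrightarrow> l \<and>
       (\<exists>y. \<phi> \<alpha> $ y = 0))"
proof (intro allI impI, elim conjE)
  fix \<alpha> :: "real ^ 's"
  assume \<alpha>: "prob_vec \<alpha>" "\<alpha> \<noteq> \<pi>"
  have lim: "(\<lambda>t. (marginal P \<alpha> t $ y - \<pi> $ y * (1 - separation P \<pi> \<alpha> t)) /
      separation P \<pi> \<alpha> t) \<longlonglongrightarrow> \<phi> \<alpha> $ y" for y
    using assms(9)[OF \<alpha>, of y]
    unfolding optimal_strong_stationary_time_conditional_law[OF assms(8)[OF \<alpha>]] .
  obtain l where l: "0 < l" "l < 1" "(\<phi> \<alpha> - \<pi>) v* P = l *\<^sub>R (\<phi> \<alpha> - \<pi>)"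
    "(\<lambda>t. separation P \<pi> \<alpha> t powr (1 / real t)) \<longlonglongrightarrow> l" "\<exists>y. \<phi> \<alpha> $ y = 0"
    using separation_residual_limit[OF assms(1,2,4,5,6,7) \<alpha> lim] by blast
  define v where "v = \<phi> \<alpha> - \<pi>"
  have \<phi>: "\<phi> \<alpha> = v + \<pi>" by (simp add: v_def)
  have span: "\<phi> \<alpha> \<in> span {v, \<pi>}"
    unfolding \<phi> by (intro span_add span_base) auto
  have "\<pi> v* mat_power P t = \<pi>" for t
    using left_eigenvector_mat_power[of \<pi> P 1 t] assms(4)
    by (simp add: stationary_distribution_def)
  then have "\<phi> \<alpha> v* mat_power P t = l ^ t *\<^sub>R \<phi> \<alpha> + (1 - l ^ t) *\<^sub>R \<pi>" for t
    using left_eigenvector_mat_power[OF l(3), of t]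
    unfolding \<phi> by (simp add: add_vector_matrix scaleR_add_right scaleR_diff_left)
  then show "\<exists>(v :: real ^ 's) (l :: real). 0 < l \<and> l < 1 \<and> v v* P = l *\<^sub>R v \<and>
       (\<phi> \<alpha> \<in> span {v, \<pi>} \<and> \<phi> \<alpha> = v + \<pi>) \<and>
       (\<forall>t. \<phi> \<alpha> v* mat_power P t = l ^ t *\<^sub>R \<phi> \<alpha> + (1 - l ^ t) *\<^sub>R \<pi>) \<and>
       (\<lambda>t. separation P \<pi> \<alpha> t powr (1 / real t)) \<longlonglongrightarrow> l \<and>
       (\<exists>y. \<phi> \<alpha> $ y = 0)"
    using l span \<phi> unfolding v_def by blast
qed

end
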